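(* Let $m,k>0$, let $r\ge1$ be an integer, and let $(P_t)_{t\in\mathcal T}$ be an $(m,k)$-ranked-spread indexed system of subsets of a finite set $U$, with distribution $\mu$ on the finite set $\mathcal T$, such that $|P_t|\le r$ for every $t\in\mathcal T$. Let $\mathcal A\subseteq\mathcal T$, put $\tau=\mu(\mathcal A)$, let $\alpha>0$ be such that $p=\frac{\alpha}{k}\le1$, and let $W\subseteq U$ be the random set containing each element of $U$ independently with probability $p$. Then $$\mathbb P_W\bigl[\nexists\, t\in\mathcal A:\ P_t\subseteq W\bigr]\le\exp\left(-\frac{\tau}{2mH_r(\alpha)}\right),\qquad H_r(\alpha)=\sum_{i=1}^r\alpha^{-i}.$$ If $\alpha>1$, then $$\mathbb P_W\bigl[\nexists\, t\in\mathcal A:\ P_t\subseteq W\bigr]\le\exp\left(-\frac{(\alpha-1)\tau}{2m}\right).$$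
   Context: A weighted indexed set system consists of a finite set $\mathcal T$ with a probability distribution $\mu$ and a set $P_t\subseteq U$ for each $t\in\mathcal T$ (different indices may carry the same set). It is $(m,k)$-ranked-spread if every nonempty $P_t$ admits an ordering $P_t=\{x_1(t),\ldots,x_{|P_t|}(t)\}$ such that, for every $i\in\{1,\dots,|P_t|\}$, $\mu(\{s\in\mathcal T: x_i(t)\in P_s\})\le m k^{-i}$. The ordering may depend on $t$. *)

theory Defs
  imports "HOL-Probability.Probability"
begin

text \<open>
  The distribution may give weight 0 to some indices of the finite set \<open>T\<close>, so only
  \<open>set_pmf \<mu> \<subseteq> T\<close> is required, not equality.
\<close>

definition weighted_set_system ::
  "'a set \<Rightarrow> 'i set \<Rightarrow> 'i pmf \<Rightarrow> ('i \<Rightarrow> 'a set) \<Rightarrow> bool" where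
  "weighted_set_system U T \<mu> P \<longleftrightarrow>
     finite T \<and> set_pmf \<mu> \<subseteq> T \<and> (\<forall>t\<in>T. P t \<subseteq> U)"

text \<open>
  The ordering \<open>x\<^sub>1(t), x\<^sub>2(t), \<dots>\<close> of \<open>P t\<close> is a bijection from \<open>{1..card (P t)}\<close>, chosen
  separately for each \<open>t\<close>, also for indices of weight 0. A nonempty infinite \<open>P t\<close> has
  \<open>card (P t) = 0\<close> and so no such ordering.
\<close>

definition ranked_spread ::
  "real \<Rightarrow> real \<Rightarrow> 'i set \<Rightarrow> 'i pmf \<Rightarrow> ('i \<Rightarrow> 'a set) \<Rightarrow> bool" where
  "ranked_spread m k T \<mu> P \<longleftrightarrow>
     (\<forall>t\<in>T. P t \<noteq> {} \<longrightarrow>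
        (\<exists>x. bij_betw x {1..card (P t)} (P t) \<and>
             (\<forall>i\<in>{1..card (P t)}.
                measure_pmf.prob \<mu> {s\<in>T. x i \<in> P s} \<le> m * k powi (- int i))))"

definition random_subset :: "'a set \<Rightarrow> real \<Rightarrow> 'a set pmf" where
  "random_subset U p =
     map_pmf (\<lambda>b. {x\<in>U. b x}) (Pi_pmf U False (\<lambda>_. bernoulli_pmf p))"

definition H :: "nat \<Rightarrow> real \<Rightarrow> real" where
  "H r \<alpha> = (\<Sum>i=1..r. \<alpha> powi (- int i))"

end

theory Submission
  imports Defs
begin

text \<open>
  Give the index \<open>t\<close> the weight \<open>w t = \<mu> t / p ^ card (P t)\<close> and let \<open>X\<close> be the total weight of
  the \<open>t \<in> A\<close> with \<open>P t \<subseteq> W\<close>, so that \<open>X\<close> has mean \<open>\<tau>\<close>. Janson's argument works with weights: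
  Harris' inequality gives that \<open>E (exp (-s X))\<close> has logarithmic derivative at most \<open>D s - \<tau>\<close>, where
  \<open>D\<close> bounds the sum of \<open>\<mu> s * \<mu> t / p ^ card (P s \<inter> P t)\<close> over intersecting pairs, and the choice
  \<open>s = \<tau> / D\<close> yields \<open>exp (- \<tau>\<^sup>2 / (2 D))\<close> as a bound for the probability that \<open>X = 0\<close>. The ranked
  spread condition allows \<open>D = \<tau> m H r \<alpha>\<close>. An index with \<open>P t = {}\<close> intersects nothing, not even
  itself, so it needs no separate treatment.
\<close>

section \<open>Random subsets: finite support, revealing one element, correlation and
  conditioning\<close>

lemma set_random_subset: "set_pmf (random_subset U p) \<subseteq> Pow U"
  by (auto simp: random_subset_def)

lemma integrable_random_subset [simp, intro]:
  fixes f :: "'a set \<Rightarrow> real"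
  assumes "finite U"
  shows "integrable (random_subset U p) f"
  by (rule integrable_measure_pmf_finite)
     (use finite_subset[OF set_random_subset] assms in auto)

text \<open>The coin of \<open>x\<close> is independent of the others, so the law splits according
  to whether \<open>x\<close> is selected. This recursion drives the inductions on the ground set
  below.\<close>

lemma expectation_random_subset_insert:
  fixes f :: "'a set \<Rightarrow> real"
  assumes "finite U" "x \<notin> U" "0 \<le> p" "p \<le> 1"
  shows "measure_pmf.expectation (random_subset (insert x U) p) f =
           p * measure_pmf.expectation (random_subset U p) (\<lambda>W. f (insert x W)) +
           (1 - p) * measure_pmf.expectation (random_subset U p) f"
proof -
  let ?B = "Pi_pmf U False (\<lambda>_. bernoulli_pmf p)"
  \<comment> \<open>The coin of \<open>x\<close> is tossed first; the remaining coins then form a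
    random subset of \<open>U\<close>.\<close>
  have eq: "random_subset (insert x U) p =
      bernoulli_pmf p \<bind> (\<lambda>y. map_pmf (\<lambda>W. if y then insert x W else W) (random_subset U p))"
    unfolding random_subset_def Pi_pmf_insert'[OF assms(1,2)] map_bind_pmf map_pmf_comp map_return_pmf
    unfolding map_pmf_def bind_return_pmf 
    by (intro bind_pmf_cong refl arg_cong[where f = return_pmf]) (use assms(2) in auto)
  have "finite (set_pmf (random_subset U p))"
    using finite_subset[OF set_random_subset] assms(1) by auto
  then have "measure_pmf.expectation (random_subset (insert x U) p) f =
      (\<Sum>y\<in>UNIV. pmf (bernoulli_pmf p) y * measure_pmf.expectation
         (map_pmf (\<lambda>W. if y then insert x W else W) (random_subset U p)) f)"
    unfolding eq by (subst pmf_expectation_bind[where A = UNIV]) auto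
  then show ?thesis using assms(3,4) by (simp add: UNIV_bool)
qed

text \<open>Harris' inequality, by revealing one element at a time: the induction hypothesis handles
  each outcome for \<open>x\<close>, and the two outcomes are combined by Chebyshev's inequality for
  a two-point distribution.\<close>

lemma harris_antimono:
  fixes f g :: "'a set \<Rightarrow> real"
  assumes "finite U" "0 \<le> p" "p \<le> 1" "antimono f" "antimono g"
  shows "measure_pmf.expectation (random_subset U p) f * measure_pmf.expectation (random_subset U p) g
           \<le> measure_pmf.expectation (random_subset U p) (\<lambda>W. f W * g W)"
  using assms(1,4,5)
proof (induction U arbitrary: f g)
  case empty
  show ?case by (simp add: random_subset_def)
next
  case (insert x U)
  let ?E = "measure_pmf.expectation (random_subset U p)"
  let ?f = "\<lambda>W. f (insert x W)" and ?g = "\<lambda>W. g (insert x W)"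
  have f': "antimono ?f" and g': "antimono ?g"
    by (auto intro!: antimonoI antimonoD[OF insert.prems(1)] antimonoD[OF insert.prems(2)])
  have "?E ?f \<le> ?E f" "?E ?g \<le> ?E g"
    using insert by (auto intro!: integral_mono intro: antimonoD)
  \<comment> \<open>This product is exactly the gap between the average of the products and the
    product of the averages over the coin of \<open>x\<close>. Both differences are nonnegative
    because selecting \<open>x\<close> lowers \<open>f\<close> and \<open>g\<close>.\<close>
  then have "0 \<le> p * (1 - p) * ((?E f - ?E ?f) * (?E g - ?E ?g))"
    using assms(2,3) by simp
  then have "(p * ?E ?f + (1 - p) * ?E f) * (p * ?E ?g + (1 - p) * ?E g)
      \<le> p * (?E ?f * ?E ?g) + (1 - p) * (?E f * ?E g)"
    by (simp add: algebra_simps)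
  also have "\<dots> \<le> p * ?E (\<lambda>W. ?f W * ?g W) + (1 - p) * ?E (\<lambda>W. f W * g W)"
    using insert.IH[OF f' g'] insert.IH[OF insert.prems] assms(2,3)
    by (intro add_mono mult_left_mono) auto
  finally show ?case
    using insert.hyps assms(2,3) by (simp add: expectation_random_subset_insert)
qed

text \<open>Enlarging the ground set can only add elements to the random set, which lowers an
  antitone function.\<close>

lemma expectation_random_subset_antimono:
  fixes f :: "'a set \<Rightarrow> real"
  assumes "finite U" "0 \<le> p" "p \<le> 1" "antimono f" "V \<subseteq> U"
  shows "measure_pmf.expectation (random_subset U p) f \<le> measure_pmf.expectation (random_subset V p) f"
proof -
  have "finite (U - V)" "finite V" using assms by (auto intro: finite_subset)
  \<comment> \<open>Writing the ground set as \<open>(U - V) \<union> V\<close> frees the induction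
    from the inclusion \<open>V \<subseteq> U\<close>; elements outside \<open>V\<close> are removed
    one by one.\<close>
  then have "measure_pmf.expectation (random_subset ((U - V) \<union> V) p) f
      \<le> measure_pmf.expectation (random_subset V p) f"
  proof (induction "U - V" arbitrary: U)
    case empty
    then show ?case by (simp add: Un_absorb1 Un_absorb2)
  next
    case (insert x F U)
    have F: "F = (U - {x}) - V" "finite F" "x \<notin> F \<union> V"
      using insert.hyps by auto
    let ?E = "measure_pmf.expectation (random_subset (F \<union> V) p)"
    have IH: "?E f \<le> measure_pmf.expectation (random_subset V p) f"
      using insert.hyps(3)[OF F(1) insert.prems] F(1) by simp
    have "?E (\<lambda>W. f (insert x W)) \<le> ?E f"
      using F insert.prems assms(4) by (auto intro!: integral_mono intro: antimonoD)
    then have "p * ?E (\<lambda>W. f (insert x W)) + (1 - p) * ?E f \<le> p * ?E f + (1 - p) * ?E f"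
      using assms(2,3) by (intro add_mono mult_left_mono) auto
    then have "measure_pmf.expectation (random_subset (insert x (F \<union> V)) p) f \<le> ?E f"
      using F insert.prems assms(2,3) by (simp add: expectation_random_subset_insert algebra_simps)
    then show ?case using IH unfolding insert.hyps(4)[symmetric] by simp
  qed
  then show ?thesis using assms(5) by (simp add: Un_absorb2)
qed

text \<open>This is conditioning on \<open>Q \<subseteq> W\<close>: the event has probability
  \<open>p ^ card Q\<close>, and given it the rest of \<open>W\<close> is still a random subset of
  \<open>U - Q\<close>.\<close>

lemma expectation_random_subset_superset:
  fixes f :: "'a set \<Rightarrow> real"
  assumes "finite U" "0 \<le> p" "p \<le> 1" "Q \<subseteq> U"
  shows "measure_pmf.expectation (random_subset U p) (\<lambda>W. of_bool (Q \<subseteq> W) * f W) =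
    p ^ card Q * measure_pmf.expectation (random_subset (U - Q) p) (\<lambda>W. f (W \<union> Q))"
proof -
  have "finite Q" using assms by (auto intro: finite_subset)
  then show ?thesis using assms(1,4)
  proof (induction Q arbitrary: U f)
    case empty
    show ?case by simp
  next
    case (insert x Q)
    let ?E = "measure_pmf.expectation (random_subset (U - {x}) p)"
    have x: "insert x (U - {x}) = U" using insert.prems by auto
    have Q: "Q \<subseteq> U - {x}" using insert by auto
    \<comment> \<open>The branch where \<open>x\<close> is not selected contributes nothing, since a
      subset of \<open>U - {x}\<close> never contains \<open>x\<close>.\<close>
    have "?E (\<lambda>W. of_bool (insert x Q \<subseteq> W) * f W) = ?E (\<lambda>_. 0)"
      using set_random_subset[of "U - {x}" p]
      by (intro integral_cong_AE) (auto simp: AE_measure_pmf_iff)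
    moreover have "?E (\<lambda>W. of_bool (insert x Q \<subseteq> insert x W) * f (insert x W)) =
        ?E (\<lambda>W. of_bool (Q \<subseteq> W) * f (insert x W))"
      using insert.hyps by (intro Bochner_Integration.integral_cong) auto
    ultimately have "measure_pmf.expectation (random_subset (insert x (U - {x})) p)
          (\<lambda>W. of_bool (insert x Q \<subseteq> W) * f W) = p * ?E (\<lambda>W. of_bool (Q \<subseteq> W) * f (insert x W))"
      using insert.prems assms(2,3)
      by (subst expectation_random_subset_insert) auto
    also have "\<dots> = p * (p ^ card Q * measure_pmf.expectation (random_subset (U - {x} - Q) p)
        (\<lambda>W. f (insert x (W \<union> Q))))"
      using insert.IH[OF _ Q, of "\<lambda>W. f (insert x W)"] insert.prems by simp
    finally show ?case
      using insert.hyps x Diff_insert2[of U x Q] by simp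
  qed
qed

lemma expectation_of_bool_subset:
  assumes "finite U" "0 \<le> p" "p \<le> 1" "Q \<subseteq> U"
  shows "measure_pmf.expectation (random_subset U p) (\<lambda>W. of_bool (Q \<subseteq> W)) = p ^ card Q"
  using expectation_random_subset_superset[OF assms, of "\<lambda>_. 1"] by simp

section \<open>Janson's inequality with weights\<close>

context
  fixes U :: "'a set" and p :: real and I :: "'i set" and w :: "'i \<Rightarrow> real" and Q :: "'i \<Rightarrow> 'a set"
  assumes U: "finite U" and p: "0 \<le> p" "p \<le> 1" and I: "finite I"
    and w: "\<And>i. i \<in> I \<Longrightarrow> 0 \<le> w i" and Q: "\<And>i. i \<in> I \<Longrightarrow> Q i \<subseteq> U"
begin

abbreviation total_weight :: "'i set \<Rightarrow> 'a set \<Rightarrow> real" where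
  "total_weight J W \<equiv> \<Sum>i\<in>J. w i * of_bool (Q i \<subseteq> W)"

text \<open>The shift by \<open>V\<close> covers both forms fed to Harris: \<open>V = Q t\<close>
  after conditioning on \<open>Q t \<subseteq> W\<close>, and \<open>V = {}\<close> without
  conditioning.\<close>

lemma antimono_exp_neg_weight:
  assumes "0 \<le> s" "J \<subseteq> I"
  shows "antimono (\<lambda>W. exp (- (s * total_weight J (W \<union> V))))"
proof (rule antimonoI)
  fix A B :: "'a set" assume "A \<le> B"
  then have "total_weight J (A \<union> V) \<le> total_weight J (B \<union> V)"
    using assms(2) w by (intro sum_mono mult_left_mono) auto
  then show "exp (- (s * total_weight J (B \<union> V))) \<le> exp (- (s * total_weight J (A \<union> V)))"
    using assms(1) by (simp add: mult_left_mono)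
qed

text \<open>
  Conditioning on \<open>Q t \<subseteq> W\<close> amounts to adding \<open>Q t\<close> to a random subset of \<open>U - Q t\<close>. The sets
  disjoint from \<open>Q t\<close> do not notice this; Harris separates them from the others, for which
  \<open>exp (-y) \<ge> 1 - y\<close>.
\<close>

lemma janson_term:
  assumes "0 \<le> s" "t \<in> I"
  shows "(p ^ card (Q t) - s * (\<Sum>i\<in>{i\<in>I. Q i \<inter> Q t \<noteq> {}}. w i * p ^ card (Q i \<union> Q t))) *
      measure_pmf.expectation (random_subset U p) (\<lambda>W. exp (- (s * total_weight I W)))
    \<le> measure_pmf.expectation (random_subset U p) (\<lambda>W. of_bool (Q t \<subseteq> W) * exp (- (s * total_weight I W)))"
proof -
  define J where "J = {i\<in>I. Q i \<inter> Q t \<noteq> {}}"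
  define K where "K = {i\<in>I. Q i \<inter> Q t = {}}"
  let ?E = "measure_pmf.expectation (random_subset U p)"
  let ?E' = "measure_pmf.expectation (random_subset (U - Q t) p)"
  have JK: "J \<subseteq> I" "K \<subseteq> I" "I = J \<union> K" "J \<inter> K = {}" by (auto simp: J_def K_def)
  have fin: "finite J" "finite K" using JK I by (auto intro: finite_subset)
  have split: "total_weight I W = total_weight J W + total_weight K W" for W
    unfolding JK(3) using fin JK(4) by (rule sum.union_disjoint)
  have XK: "total_weight K (W \<union> Q t) = total_weight K W" for W
    by (intro sum.cong refl arg_cong2[where f = "(*)"] arg_cong[where f = of_bool])
       (auto simp: K_def)
  have XK_le: "total_weight K W \<le> total_weight I W" for W
    unfolding split using w JK by (intro le_add_same_cancel2[THEN iffD2] sum_nonneg) auto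
  \<comment> \<open>Two losses in the same direction: the ground set shrinks to
    \<open>U - Q t\<close>, then the weight of \<open>J\<close> is dropped from the
    exponent.\<close>
  have "?E (\<lambda>W. exp (- (s * total_weight I W))) \<le> ?E' (\<lambda>W. exp (- (s * total_weight I W)))"
    using expectation_random_subset_antimono[OF U p antimono_exp_neg_weight[of s I "{}"], of "U - Q t"] assms(1)
    by simp
  also have "\<dots> \<le> ?E' (\<lambda>W. exp (- (s * total_weight K W)))"
    using U XK_le assms(1) by (intro integral_mono) (auto intro: mult_left_mono)
  finally have far: "?E (\<lambda>W. exp (- (s * total_weight I W))) \<le> ?E' (\<lambda>W. exp (- (s * total_weight K W)))" .
  \<comment> \<open>\<open>Q i\<close> and \<open>Q t\<close> both lie in \<open>W\<close> exactly
    when their union does, which has probability \<open>p ^ card (Q i \<union> Q t)\<close>.\<close>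
  have "?E (\<lambda>W. of_bool (Q t \<subseteq> W) * total_weight J W) = (\<Sum>i\<in>J. w i * p ^ card (Q i \<union> Q t))"
  proof -
    have "?E (\<lambda>W. of_bool (Q t \<subseteq> W) * total_weight J W) =
        ?E (\<lambda>W. \<Sum>i\<in>J. w i * of_bool (Q i \<union> Q t \<subseteq> W))"
      by (intro Bochner_Integration.integral_cong refl) (auto simp: sum_distrib_left intro!: sum.cong)
    also have "\<dots> = (\<Sum>i\<in>J. w i * ?E (\<lambda>W. of_bool (Q i \<union> Q t \<subseteq> W)))"
      using U by (subst Bochner_Integration.integral_sum) auto
    also have "\<dots> = (\<Sum>i\<in>J. w i * p ^ card (Q i \<union> Q t))"
      using Q JK assms(2) by (intro sum.cong refl arg_cong2[where f = "(*)"] expectation_of_bool_subset U p) blast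
    finally show ?thesis .
  qed
  then have near: "p ^ card (Q t) * ?E' (\<lambda>W. total_weight J (W \<union> Q t)) = (\<Sum>i\<in>J. w i * p ^ card (Q i \<union> Q t))"
    using expectation_random_subset_superset[OF U p Q[OF assms(2)], of "total_weight J"] by simp
  have "1 - s * ?E' (\<lambda>W. total_weight J (W \<union> Q t)) = ?E' (\<lambda>W. 1 - s * total_weight J (W \<union> Q t))"
    using U by (subst Bochner_Integration.integral_diff) auto
  also have "\<dots> \<le> ?E' (\<lambda>W. exp (- (s * total_weight J (W \<union> Q t))))"
  proof (intro integral_mono)
    fix W show "1 - s * total_weight J (W \<union> Q t) \<le> exp (- (s * total_weight J (W \<union> Q t)))"
      using exp_ge_add_one_self[of "- (s * total_weight J (W \<union> Q t))"] by simp
  qed (use U in auto)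
  finally have lin: "1 - s * ?E' (\<lambda>W. total_weight J (W \<union> Q t)) \<le> ?E' (\<lambda>W. exp (- (s * total_weight J (W \<union> Q t))))" .
  \<comment> \<open>The linear factor on the left may be negative; monotonicity of the product only
    requires its upper bound and the other left factor to be nonnegative.\<close>
  have "(1 - s * ?E' (\<lambda>W. total_weight J (W \<union> Q t))) * ?E (\<lambda>W. exp (- (s * total_weight I W)))
      \<le> ?E' (\<lambda>W. exp (- (s * total_weight J (W \<union> Q t)))) * ?E' (\<lambda>W. exp (- (s * total_weight K W)))"
    using far lin by (intro mult_mono) (auto intro: Bochner_Integration.integral_nonneg)
  also have "\<dots> \<le> ?E' (\<lambda>W. exp (- (s * total_weight J (W \<union> Q t))) * exp (- (s * total_weight K (W \<union> {}))))"
    using harris_antimono[OF _ p antimono_exp_neg_weight[OF assms(1) JK(1), of "Q t"]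
        antimono_exp_neg_weight[OF assms(1) JK(2), of "{}"], of "U - Q t"] U by simp
  also have "\<dots> = ?E' (\<lambda>W. exp (- (s * total_weight I (W \<union> Q t))))"
    by (simp only: split XK Un_empty_right distrib_left minus_add_distrib exp_add)
  finally have "p ^ card (Q t) * ((1 - s * ?E' (\<lambda>W. total_weight J (W \<union> Q t))) * ?E (\<lambda>W. exp (- (s * total_weight I W))))
      \<le> p ^ card (Q t) * ?E' (\<lambda>W. exp (- (s * total_weight I (W \<union> Q t))))"
    using p by (intro mult_left_mono) auto
  also have "\<dots> = ?E (\<lambda>W. of_bool (Q t \<subseteq> W) * exp (- (s * total_weight I W)))"
    using expectation_random_subset_superset[OF U p Q[OF assms(2)]] by simp
  finally show ?thesis
    unfolding J_def[symmetric] near[symmetric] by (simp add: algebra_simps)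
qed

text \<open>A Gronwall argument: summing \<open>janson_term\<close> with weights \<open>w t\<close>
  bounds the logarithmic derivative of the transform by \<open>D * s - L\<close>, with
  \<open>L\<close> the mean weight. The transform is 1 at 0, and integration gives the
  exponent.\<close>

lemma laplace_transform_le:
  assumes "0 \<le> s"
    and "(\<Sum>t\<in>I. w t * (\<Sum>i\<in>{i\<in>I. Q i \<inter> Q t \<noteq> {}}. w i * p ^ card (Q i \<union> Q t))) \<le> D"
  shows "measure_pmf.expectation (random_subset U p) (\<lambda>W. exp (- (s * total_weight I W)))
    \<le> exp (D * s\<^sup>2 / 2 - (\<Sum>t\<in>I. w t * p ^ card (Q t)) * s)"
proof -
  let ?E = "measure_pmf.expectation (random_subset U p)"
  define L where "L = (\<Sum>t\<in>I. w t * p ^ card (Q t))"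
  define \<Psi> where "\<Psi> s = ?E (\<lambda>W. exp (- (s * total_weight I W)))" for s
  \<comment> \<open>All mass sits on the finite set \<open>Pow U\<close>, so the expectation is a
    finite sum and can be differentiated in \<open>s\<close> term by term.\<close>
  have E_sum: "?E f = (\<Sum>W\<in>Pow U. f W * pmf (random_subset U p) W)" for f :: "'a set \<Rightarrow> real"
    using U set_random_subset[of U p] by (intro integral_measure_pmf_real) auto
  have deriv: "(\<Psi> has_real_derivative - ?E (\<lambda>W. total_weight I W * exp (- (s * total_weight I W)))) (at s)" for s
  proof -
    have "((\<lambda>s. exp (- (s * a)) * c) has_real_derivative - (a * exp (- (s * a)) * c)) (at s)" for a c :: real
      by (auto intro!: derivative_eq_intros)
    then show ?thesis
      unfolding \<Psi>_def E_sum sum_negf[symmetric] by (intro DERIV_sum)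
  qed
  have ineq: "(L - D * s) * \<Psi> s \<le> ?E (\<lambda>W. total_weight I W * exp (- (s * total_weight I W)))" if "0 \<le> s" for s
  proof -
    have "0 \<le> \<Psi> s" unfolding \<Psi>_def by (intro Bochner_Integration.integral_nonneg) simp
    then have "(L - D * s) * \<Psi> s \<le> (L - s * (\<Sum>t\<in>I. w t * (\<Sum>i\<in>{i\<in>I. Q i \<inter> Q t \<noteq> {}}. w i * p ^ card (Q i \<union> Q t)))) * \<Psi> s"
      using mult_left_mono[OF assms(2) that] by (intro mult_right_mono) (auto simp: mult.commute)
    also have "\<dots> = (\<Sum>t\<in>I. w t * ((p ^ card (Q t) - s * (\<Sum>i\<in>{i\<in>I. Q i \<inter> Q t \<noteq> {}}. w i * p ^ card (Q i \<union> Q t))) * \<Psi> s))"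
    proof -
      have "(L - s * (\<Sum>t\<in>I. w t * B t)) * \<Psi> s = (\<Sum>t\<in>I. w t * ((p ^ card (Q t) - s * B t) * \<Psi> s))" for B
        unfolding L_def sum_distrib_left sum_subtractf[symmetric] sum_distrib_right
        by (intro sum.cong refl) (simp add: algebra_simps)
      then show ?thesis .
    qed
    also have "\<dots> \<le> (\<Sum>t\<in>I. w t * ?E (\<lambda>W. of_bool (Q t \<subseteq> W) * exp (- (s * total_weight I W))))"
      unfolding \<Psi>_def using w janson_term[OF that] by (intro sum_mono mult_left_mono) auto
    also have "\<dots> = ?E (\<lambda>W. \<Sum>t\<in>I. w t * (of_bool (Q t \<subseteq> W) * exp (- (s * total_weight I W))))"
      using U by (subst Bochner_Integration.integral_sum) auto
    also have "\<dots> = ?E (\<lambda>W. total_weight I W * exp (- (s * total_weight I W)))"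
      by (simp only: sum_distrib_right mult.assoc)
    finally show ?thesis .
  qed
  \<comment> \<open>The second factor is the integrating factor of the differential inequality; it
    makes the product nonincreasing from 0 on.\<close>
  have "\<Psi> s * exp (L * s - D * s\<^sup>2 / 2) \<le> \<Psi> 0 * exp (L * 0 - D * 0\<^sup>2 / 2)"
  proof (rule DERIV_nonpos_imp_nonincreasing[OF assms(1)])
    fix x assume "0 \<le> x" "x \<le> s"
    have "((\<lambda>s. \<Psi> s * exp (L * s - D * s\<^sup>2 / 2)) has_real_derivative
        ((L - D * x) * \<Psi> x - ?E (\<lambda>W. total_weight I W * exp (- (x * total_weight I W)))) * exp (L * x - D * x\<^sup>2 / 2)) (at x)"
    proof -
      have "((\<lambda>s. exp (L * s - D * s\<^sup>2 / 2)) has_real_derivative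
          exp (L * x - D * x\<^sup>2 / 2) * (L - D * x)) (at x)"
        by (auto intro!: derivative_eq_intros)
      from DERIV_mult[OF deriv this] show ?thesis
        by (rule DERIV_cong) (simp only: algebra_simps)
    qed
    moreover have "((L - D * x) * \<Psi> x - ?E (\<lambda>W. total_weight I W * exp (- (x * total_weight I W)))) * exp (L * x - D * x\<^sup>2 / 2) \<le> 0"
      using ineq[OF \<open>0 \<le> x\<close>] by (intro mult_nonpos_nonneg) auto
    ultimately show "\<exists>y. ((\<lambda>s. \<Psi> s * exp (L * s - D * s\<^sup>2 / 2)) has_real_derivative y) (at x) \<and> y \<le> 0"
      by blast
  qed
  then have "\<Psi> s * exp (L * s - D * s\<^sup>2 / 2) \<le> 1" by (simp add: \<Psi>_def)
  then have "\<Psi> s \<le> exp (- (L * s - D * s\<^sup>2 / 2))"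
    by (simp add: exp_minus field_simps)
  then show ?thesis by (simp add: \<Psi>_def L_def)
qed

text \<open>An exponential Markov bound: when no \<open>Q t\<close> lies in \<open>W\<close> the
  total weight is 0 and \<open>exp (- (s * total_weight I W))\<close> equals 1, so its mean
  dominates the probability. The choice \<open>s = L / D\<close> minimises
  \<open>D * s\<^sup>2 / 2 - L * s\<close>.\<close>

lemma weighted_janson:
  assumes "0 < D"
    and "(\<Sum>t\<in>I. w t * (\<Sum>i\<in>{i\<in>I. Q i \<inter> Q t \<noteq> {}}. w i * p ^ card (Q i \<union> Q t))) \<le> D"
  shows "measure_pmf.prob (random_subset U p) {W. \<not> (\<exists>t\<in>I. Q t \<subseteq> W)}
    \<le> exp (- ((\<Sum>t\<in>I. w t * p ^ card (Q t))\<^sup>2 / (2 * D)))"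
proof -
  let ?E = "measure_pmf.expectation (random_subset U p)"
  define L where "L = (\<Sum>t\<in>I. w t * p ^ card (Q t))"
  have "0 \<le> L" unfolding L_def using w p by (intro sum_nonneg) auto
  have "measure_pmf.prob (random_subset U p) {W. \<not> (\<exists>t\<in>I. Q t \<subseteq> W)} =
      ?E (indicator {W. \<not> (\<exists>t\<in>I. Q t \<subseteq> W)})"
    by simp
  also have "\<dots> \<le> ?E (\<lambda>W. exp (- (L / D * total_weight I W)))"
    using U by (intro integral_mono) (auto split: split_indicator)
  also have "\<dots> \<le> exp (D * (L / D)\<^sup>2 / 2 - L * (L / D))"
    unfolding L_def by (intro laplace_transform_le assms) (use \<open>0 \<le> L\<close> assms(1) in \<open>simp add: L_def\<close>)
  also have "D * (L / D)\<^sup>2 / 2 - L * (L / D) = - (L\<^sup>2 / (2 * D))"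
    using assms(1) by (simp add: field_simps power2_eq_square)
  finally show ?thesis unfolding L_def .
qed

end

section \<open>Overlap sums under the ranked spread condition, and bounds on
  \<open>H\<close>\<close>

text \<open>
  If \<open>i\<close> is the largest rank of an element of \<open>P s \<inter> P t\<close>, then \<open>card (P s \<inter> P t) \<le> i\<close>, so the
  summand at \<open>s\<close> is at most the term \<open>pmf \<mu> s / p ^ i\<close> that \<open>s\<close> contributes for this rank alone.
\<close>

lemma ranked_spread_sum_le:
  assumes "ranked_spread m k T \<mu> P" "finite T" "t \<in> T" "finite (P t)" "card (P t) \<le> r"
    and "0 < m" "0 < \<alpha>" "0 < k" "\<alpha> / k \<le> 1"
  shows "(\<Sum>s\<in>{s\<in>T. P s \<inter> P t \<noteq> {}}. pmf \<mu> s / (\<alpha> / k) ^ card (P s \<inter> P t)) \<le> m * H r \<alpha>"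
proof (cases "P t = {}")
  case True
  then show ?thesis using assms by (auto simp: H_def intro!: mult_nonneg_nonneg sum_nonneg)
next
  case False
  define p where "p = \<alpha> / k"
  have p: "0 < p" "p \<le> 1" using assms by (auto simp: p_def)
  define n where "n = card (P t)"
  obtain x where x: "bij_betw x {1..n} (P t)"
    and mu: "\<And>i. i \<in> {1..n} \<Longrightarrow> measure_pmf.prob \<mu> {s\<in>T. x i \<in> P s} \<le> m * k powi (- int i)"
    using assms(1,3) False unfolding ranked_spread_def n_def by blast
  have pointwise: "1 / p ^ card (P s \<inter> P t) \<le> (\<Sum>i=1..n. of_bool (x i \<in> P s) / p ^ i)"
    if "P s \<inter> P t \<noteq> {}" for s
  proof -
    define N where "N = {i\<in>{1..n}. x i \<in> P s}"
    have img: "P s \<inter> P t = x ` N"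
      unfolding bij_betw_imp_surj_on[OF x, symmetric] by (auto simp: N_def)
    have "N \<noteq> {}" using that img by auto
    have fin: "finite N" by (simp add: N_def)
    define M where "M = Max N"
    have M: "M \<in> N" unfolding M_def using fin \<open>N \<noteq> {}\<close> by simp
    have "N \<subseteq> {1..M}" using fin by (auto simp: M_def N_def)
    then have "card N \<le> M" using card_mono[of "{1..M}" N] by simp
    then have "card (P s \<inter> P t) \<le> M" unfolding img using card_image_le[OF fin, of x] by linarith
    then have "1 / p ^ card (P s \<inter> P t) \<le> 1 / p ^ M"
      using p by (intro divide_left_mono power_decreasing) auto
    also have "\<dots> = of_bool (x M \<in> P s) / p ^ M" using M by (simp add: N_def)
    also have "\<dots> \<le> (\<Sum>i=1..n. of_bool (x i \<in> P s) / p ^ i)"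
      using M p by (intro member_le_sum) (auto simp: N_def)
    finally show ?thesis .
  qed
  have "(\<Sum>s\<in>{s\<in>T. P s \<inter> P t \<noteq> {}}. pmf \<mu> s / p ^ card (P s \<inter> P t))
      \<le> (\<Sum>s\<in>{s\<in>T. P s \<inter> P t \<noteq> {}}. pmf \<mu> s * (\<Sum>i=1..n. of_bool (x i \<in> P s) / p ^ i))"
  proof (rule sum_mono)
    fix s assume "s \<in> {s\<in>T. P s \<inter> P t \<noteq> {}}"
    then show "pmf \<mu> s / p ^ card (P s \<inter> P t) \<le> pmf \<mu> s * (\<Sum>i=1..n. of_bool (x i \<in> P s) / p ^ i)"
      using mult_left_mono[OF pointwise[of s], of "pmf \<mu> s"] by simp
  qed
  also have "\<dots> \<le> (\<Sum>s\<in>T. pmf \<mu> s * (\<Sum>i=1..n. of_bool (x i \<in> P s) / p ^ i))"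
    using assms(2) p by (intro sum_mono2) (auto intro!: mult_nonneg_nonneg sum_nonneg)
  also have "\<dots> = (\<Sum>i=1..n. (\<Sum>s\<in>T. of_bool (x i \<in> P s) * pmf \<mu> s) / p ^ i)"
    unfolding sum_distrib_left sum_divide_distrib
    by (subst sum.swap) (simp add: mult.commute)
  also have "\<dots> = (\<Sum>i=1..n. measure_pmf.prob \<mu> {s\<in>T. x i \<in> P s} / p ^ i)"
    using assms(2) by (simp add: measure_measure_pmf_finite Int_def)
  also have "\<dots> \<le> (\<Sum>i=1..n. m * \<alpha> powi (- int i))"
  proof (intro sum_mono)
    fix i assume "i \<in> {1..n}"
    then have "measure_pmf.prob \<mu> {s\<in>T. x i \<in> P s} / p ^ i \<le> m * k powi (- int i) / p ^ i"
      using mu p by (intro divide_right_mono) auto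
    \<comment> \<open>Since \<open>p = \<alpha> / k\<close>, the powers of \<open>k\<close> cancel
      and only those of \<open>\<alpha>\<close> remain.\<close>
    also have "\<dots> = m * \<alpha> powi (- int i)"
      using assms by (simp add: p_def power_int_minus field_simps)
    finally show "measure_pmf.prob \<mu> {s\<in>T. x i \<in> P s} / p ^ i \<le> m * \<alpha> powi (- int i)" .
  qed
  also have "\<dots> \<le> (\<Sum>i=1..r. m * \<alpha> powi (- int i))"
    using assms by (intro sum_mono2) (auto simp: n_def)
  also have "\<dots> = m * H r \<alpha>" by (simp add: H_def sum_distrib_left)
  finally show ?thesis unfolding p_def .
qed

lemma H_pos: "0 < \<alpha> \<Longrightarrow> 1 \<le> r \<Longrightarrow> 0 < H r \<alpha>"
  unfolding H_def by (intro sum_pos) auto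

text \<open>Multiplying the geometric sum by \<open>\<alpha> - 1\<close> telescopes it to
  \<open>1 - \<alpha> powi (- int r)\<close>.\<close>

lemma H_le:
  assumes "1 < \<alpha>"
  shows "(\<alpha> - 1) * H r \<alpha> \<le> 1"
proof -
  have "(\<alpha> - 1) * H r \<alpha> = 1 - \<alpha> powi (- int r)"
    using assms by (induction r) (simp_all add: H_def power_int_minus field_simps del: of_nat_Suc)
  then show ?thesis using assms by simp
qed

section \<open>Application of Janson's inequality to the indices in \<open>A\<close>\<close>

theorem theorem3p2:
  fixes U :: "'a set" and T A :: "'i set" and \<mu> :: "'i pmf" and P :: "'i \<Rightarrow> 'a set"
    and m k \<alpha> p \<tau> :: real and r :: nat
  assumes "m > 0" and "k > 0" and "r \<ge> 1"
    and "finite U"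
    and "weighted_set_system U T \<mu> P"
    and "ranked_spread m k T \<mu> P"
    and "\<And>t. t \<in> T \<Longrightarrow> card (P t) \<le> r"
    and "A \<subseteq> T" and "\<tau> = measure_pmf.prob \<mu> A"
    and "\<alpha> > 0" and "p = \<alpha> / k" and "p \<le> 1"
  shows "measure_pmf.prob (random_subset U p) {W. \<not> (\<exists>t\<in>A. P t \<subseteq> W)}
           \<le> exp (- (\<tau> / (2 * m * H r \<alpha>)))
       \<and> (\<alpha> > 1 \<longrightarrow>
           measure_pmf.prob (random_subset U p) {W. \<not> (\<exists>t\<in>A. P t \<subseteq> W)}
             \<le> exp (- ((\<alpha> - 1) * \<tau> / (2 * m))))"
\<comment> \<open>For \<open>\<tau> = 0\<close> both bounds equal 1. The case is separate because
  the overlap bound \<open>\<tau> * (m * H r \<alpha>)\<close> must be positive in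
  \<open>weighted_janson\<close>.\<close>
proof (cases "\<tau> = 0")
  case True
  then show ?thesis by simp
next
  case False
  then have \<tau>: "0 < \<tau>" using assms(9) by (simp add: zero_less_measure_iff)
  have p: "0 < p" using assms by simp
  have T: "finite T" "\<And>t. t \<in> T \<Longrightarrow> P t \<subseteq> U"
    using assms(5) by (auto simp: weighted_set_system_def)
  have A: "finite A" using T assms(8) by (auto intro: finite_subset)
  have fin: "finite (P t)" if "t \<in> T" for t using T(2)[OF that] assms(4) by (rule finite_subset)
  have Hpos: "0 < H r \<alpha>" using assms by (intro H_pos)
  define w where "w t = pmf \<mu> t / p ^ card (P t)" for t
  have \<tau>_sum: "\<tau> = (\<Sum>t\<in>A. pmf \<mu> t)" using A assms(9) by (simp add: measure_measure_pmf_finite)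
  have mean: "(\<Sum>t\<in>A. w t * p ^ card (P t)) = \<tau>"
    unfolding \<tau>_sum w_def using p by simp
  have "(\<Sum>t\<in>A. w t * (\<Sum>s\<in>{s\<in>A. P s \<inter> P t \<noteq> {}}. w s * p ^ card (P s \<union> P t)))
      = (\<Sum>t\<in>A. pmf \<mu> t * (\<Sum>s\<in>{s\<in>A. P s \<inter> P t \<noteq> {}}. pmf \<mu> s / p ^ card (P s \<inter> P t)))"
    unfolding sum_distrib_left
  proof (intro sum.cong refl)
    fix s t assume "t \<in> A" "s \<in> {s\<in>A. P s \<inter> P t \<noteq> {}}"
    \<comment> \<open>Inclusion-exclusion for cardinalities: dividing
      \<open>p ^ card (P s \<union> P t)\<close> by both normalising powers leaves the reciprocal of
      \<open>p ^ card (P s \<inter> P t)\<close>.\<close>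
    then have "card (P s) + card (P t) = card (P s \<union> P t) + card (P s \<inter> P t)"
      using fin assms(8) by (intro card_Un_Int) auto
    then have "p ^ card (P s) * p ^ card (P t) = p ^ card (P s \<union> P t) * p ^ card (P s \<inter> P t)"
      by (simp flip: power_add)
    then show "w t * (w s * p ^ card (P s \<union> P t)) = pmf \<mu> t * (pmf \<mu> s / p ^ card (P s \<inter> P t))"
      using p by (simp add: w_def divide_simps mult.commute)
  qed
  also have "\<dots> \<le> (\<Sum>t\<in>A. pmf \<mu> t * (m * H r \<alpha>))"
  proof (intro sum_mono mult_left_mono)
    fix t assume "t \<in> A"
    have "(\<Sum>s\<in>{s\<in>A. P s \<inter> P t \<noteq> {}}. pmf \<mu> s / p ^ card (P s \<inter> P t))
        \<le> (\<Sum>s\<in>{s\<in>T. P s \<inter> P t \<noteq> {}}. pmf \<mu> s / p ^ card (P s \<inter> P t))"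
      using T(1) assms(8) p by (intro sum_mono2) auto
    also have "\<dots> \<le> m * H r \<alpha>"
      unfolding assms(11) using \<open>t \<in> A\<close> assms T fin by (intro ranked_spread_sum_le) auto
    finally show "(\<Sum>s\<in>{s\<in>A. P s \<inter> P t \<noteq> {}}. pmf \<mu> s / p ^ card (P s \<inter> P t)) \<le> m * H r \<alpha>" .
  qed simp
  also have "\<dots> = \<tau> * (m * H r \<alpha>)" by (simp only: \<tau>_sum sum_distrib_right)
  finally have overlap: "(\<Sum>t\<in>A. w t * (\<Sum>s\<in>{s\<in>A. P s \<inter> P t \<noteq> {}}. w s * p ^ card (P s \<union> P t)))
      \<le> \<tau> * (m * H r \<alpha>)" .
  \<comment> \<open>The mean weight is \<open>\<tau>\<close> and the overlap bound is linear in
    \<open>\<tau>\<close>, so one factor \<open>\<tau>\<close> cancels in the exponent.\<close>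
  have "measure_pmf.prob (random_subset U p) {W. \<not> (\<exists>t\<in>A. P t \<subseteq> W)}
      \<le> exp (- ((\<Sum>t\<in>A. w t * p ^ card (P t))\<^sup>2 / (2 * (\<tau> * (m * H r \<alpha>)))))"
    using overlap p \<tau> Hpos assms T A by (intro weighted_janson) (auto simp: w_def)
  also have "\<dots> = exp (- (\<tau> / (2 * m * H r \<alpha>)))"
    unfolding mean using \<tau> by (simp add: power2_eq_square)
  finally have main: "measure_pmf.prob (random_subset U p) {W. \<not> (\<exists>t\<in>A. P t \<subseteq> W)}
      \<le> exp (- (\<tau> / (2 * m * H r \<alpha>)))" .
  have "exp (- (\<tau> / (2 * m * H r \<alpha>))) \<le> exp (- ((\<alpha> - 1) * \<tau> / (2 * m)))" if "1 < \<alpha>"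
  proof -
    have "\<alpha> - 1 \<le> 1 / H r \<alpha>"
      using H_le[OF that] Hpos by (simp add: pos_le_divide_eq)
    then have "(\<alpha> - 1) * \<tau> / (2 * m) \<le> 1 / H r \<alpha> * \<tau> / (2 * m)"
      using \<tau> assms(1) by (intro divide_right_mono mult_right_mono) auto
    then show ?thesis by (simp add: mult.commute)
  qed
  then show ?thesis using main by (auto intro: order_trans)
qed

end
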